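(* Let $\{\gamma_n\}_{n=0}^\infty$ be a sequence of real numbers and $\{Q_k(x)\}_{k=0}^\infty$ a sequence of real polynomials such that $$T[H_n(x)]:=\left(\sum_{k=0}^\infty Q_k(x)D^k\right)H_n(x)=\gamma_nH_n(x)\qquad\text{for all } n\in\mathbb{N}_0.$$ Then for each $m\in\mathbb{N}_0$, $$Q_m(x)=\sum_{k=0}^{\lfloor m/2\rfloor} \frac{(-1)^k}{k!\,2^k} \left(\sum_{j=0}^k \binom{k}{j} \frac{g_{m-k+j}^*(-1)}{2^{j}}\right)\frac{x^{m-2k}}{(m-2k)!},$$ where $\{g_k^*(x)\}_{k=0}^\infty$ are the reversed Jensen polynomials associated with $\{\gamma_n\}_{n=0}^\infty$.
   Context: $\mathbb{N}_0=\{0,1,2,\ldots\}$ and $D:=\frac{d}{dx}$. The Hermite polynomials are $H_n(x)=\sum_{k=0}^{\lfloor n/2\rfloor}\frac{(-1)^k n!\,2^{n-2k}}{k!(n-2k)!}x^{n-2k}$. The reversed Jensen polynomials associated with $\{\gamma_k\}_{k=0}^\infty$ are $g_n^*(x):=\sum_{k=0}^n\binom{n}{k}\gamma_kx^{n-k}$, $n\in\mathbb{N}_0$. The operator $\sum_{k}Q_kD^k$ acts on polynomials, so only finitely many terms contribute. *)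

theory Defs
  imports "HOL-Computational_Algebra.Polynomial" "HOL-Library.Groups_Big_Fun"
begin

definition hermite_poly :: "nat \<Rightarrow> real poly" where
  "hermite_poly n = (\<Sum>k\<le>n div 2.
     monom ((-1) ^ k * fact n * 2 ^ (n - 2 * k) / (fact k * fact (n - 2 * k))) (n - 2 * k))"

definition rev_jensen_poly :: "(nat \<Rightarrow> real) \<Rightarrow> nat \<Rightarrow> real poly" where
  "rev_jensen_poly \<gamma> n = (\<Sum>k\<le>n. monom (of_nat (n choose k) * \<gamma> k) (n - k))"

text \<open>
  The operator with coefficients \<open>Q\<close> is a formal infinite series in the derivative. On a polynomial
  only finitely many of its terms are nonzero, so \<open>Sum_any\<close> is the intended sum; the
  lemmas below confirm that it never falls back to its default value 0.
\<close>

definition diff_op :: "(nat \<Rightarrow> real poly) \<Rightarrow> real poly \<Rightarrow> real poly" where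
  "diff_op Q p = Sum_any (\<lambda>k. Q k * (pderiv ^^ k) p)"

lemma higher_pderiv_eq_0:
  fixes p :: "real poly"
  assumes "degree p < k"
  shows "(pderiv ^^ k) p = 0"
  using assms by (intro poly_eqI) (simp add: coeff_higher_pderiv coeff_eq_0)

lemma finite_diff_op_terms: "finite {k. Q k * (pderiv ^^ k) (p :: real poly) \<noteq> 0}"
  by (rule finite_subset[of _ "{..degree p}"]) (auto simp: not_less[symmetric] higher_pderiv_eq_0)

lemma diff_op_eq_sum: "diff_op Q p = (\<Sum>k\<le>degree p. Q k * (pderiv ^^ k) p)"
  unfolding diff_op_def
  by (rule Sum_any.expand_superset) (auto simp: not_less[symmetric] higher_pderiv_eq_0)

end

theory Submission
  imports Defs "HOL-Computational_Algebra.Polynomial_FPS"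
begin

text \<open>
  The coefficients are read off from the symbol of the operator. Fix a real \<open>x\<close> and let
  \<open>G(t) = (\<Sum>n. H\<^sub>n(x) t^n / n!) = exp (2 x t - t\<^sup>2)\<close> be the exponential generating function of the
  Hermite polynomials. As a function of \<open>x\<close> it is an eigenfunction of \<open>D\<close> with eigenvalue \<open>2 t\<close>, so
  the operator with coefficients \<open>Q\<^sub>m\<close> multiplies it by the symbol
  \<open>S(t) = (\<Sum>m. Q\<^sub>m(x) (2 t)^m)\<close>, and the hypothesis becomes
  \<open>S(t) G(t) = (\<Sum>n. \<gamma>\<^sub>n H\<^sub>n(x) t^n / n!)\<close> (lemma \<open>symbol_mult_hermite_egf_nth\<close>). Since \<open>G\<close> is
  invertible, this determines \<open>S\<close>.

  To divide by \<open>G\<close>, write \<open>c\<^sub>i = g\<^sub>i\<^sup>*(-1)\<close>. These are the iterated differences of \<open>\<gamma>\<close> at \<open>0\<close>, whence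
  \<open>\<gamma>\<^sub>n = (\<Sum>i\<le>n. (n choose i) c\<^sub>i)\<close> (\<open>binomial_inversion_rev_jensen\<close>). Weighting the coefficients of \<open>G\<close>
  by \<open>n choose i\<close> amounts to applying \<open>t^i / i!\<close> times the \<open>i\<close>-th derivative in \<open>t\<close>, and a Rodrigues
  formula evaluates that derivative: it is \<open>H\<^sub>i(x - t) G(t)\<close>
  (\<open>higher_fps_deriv_hermite_egf\<close>). So \<open>G\<close> cancels and
  \<open>S(t) = (\<Sum>i. c\<^sub>i t^i / i! H\<^sub>i(x - t))\<close> (\<open>symbol_nth\<close>). Expanding \<open>H\<^sub>i(x - t)\<close> by the binomial theorem and
  comparing coefficients of \<open>t^m\<close> gives the claim as an identity of polynomial functions of \<open>x\<close>.

  All of this takes place in formal power series in \<open>t\<close> over the reals. The closed form of \<open>G\<close> only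
  guides the argument: it enters through the differential equation \<open>G' = 2 (x - t) G\<close>, which follows
  from the recurrences of the Hermite polynomials, and through \<open>G(0) = 1\<close>, which makes \<open>G\<close> a unit.
\<close>

unbundle fps_syntax

section \<open>Hermite polynomials\<close>

lemma coeff_hermite_poly:
  "coeff (hermite_poly n) d =
     (if d \<le> n \<and> even (n - d)
      then (-1) ^ ((n - d) div 2) * fact n * 2 ^ d / (fact ((n - d) div 2) * fact d) else 0)"
proof -
  let ?c = "\<lambda>k. (-1) ^ k * fact n * 2 ^ (n - 2 * k) / (fact k * fact (n - 2 * k)) :: real"
  have "coeff (hermite_poly n) d = (\<Sum>k\<le>n div 2. if n - 2 * k = d then ?c k else 0)"
    by (simp add: hermite_poly_def coeff_sum)
  also have "\<dots> = (\<Sum>k\<le>n div 2. if k = (n - d) div 2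
      then (if d \<le> n \<and> even (n - d) then ?c k else 0) else 0)"
  proof (rule sum.cong)
    fix k assume "k \<in> {..n div 2}"
    then have "n = n - 2 * k + 2 * k" by auto
    then have "n - 2 * k = d \<longleftrightarrow> n = d + 2 * k" by auto
    also have "\<dots> \<longleftrightarrow> k = (n - d) div 2 \<and> d \<le> n \<and> even (n - d)"
    proof
      assume "k = (n - d) div 2 \<and> d \<le> n \<and> even (n - d)"
      then show "n = d + 2 * k" by (simp del: even_diff_nat)
    qed simp
    finally have iff: "n - 2 * k = d \<longleftrightarrow> k = (n - d) div 2 \<and> d \<le> n \<and> even (n - d)" .
    show "(if n - 2 * k = d then ?c k else 0) = (if k = (n - d) div 2
        then (if d \<le> n \<and> even (n - d) then ?c k else 0) else 0)"
      by (simp only: iff if_if_eq_conj)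
  qed simp
  also have "\<dots> = (if d \<le> n \<and> even (n - d) then ?c ((n - d) div 2) else 0)"
    by (simp add: div_le_mono)
  finally show ?thesis
    by (auto elim!: evenE)
qed

text \<open>
  Indexing by \<open>n = d + 2 * k\<close> removes the truncated subtraction, the division and the parity
  condition; the recurrences below compare coefficients in this form.
\<close>

lemma coeff_hermite_poly_add [simp]:
  "coeff (hermite_poly (d + 2 * k)) d = (-1) ^ k * fact (d + 2 * k) * 2 ^ d / (fact k * fact d)"
  by (simp add: coeff_hermite_poly)

lemma coeff_hermite_poly_eq_0:
  assumes "\<And>k. n \<noteq> d + 2 * k"
  shows "coeff (hermite_poly n) d = 0"
proof -
  have "\<not> (d \<le> n \<and> even (n - d))"
  proof
    assume "d \<le> n \<and> even (n - d)"
    then have "n = d + 2 * ((n - d) div 2)" by (simp del: even_diff_nat)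
    with assms show False by blast
  qed
  then show ?thesis by (simp add: coeff_hermite_poly)
qed

lemma hermite_poly_0 [simp]: "hermite_poly 0 = 1"
  by (simp add: hermite_poly_def monom_0 flip: one_pCons)

lemma degree_hermite_poly_le: "degree (hermite_poly n) \<le> n"
  by (rule degree_le) (simp add: coeff_hermite_poly)

lemma pderiv_hermite_poly_Suc:
  "pderiv (hermite_poly (Suc n)) = smult (2 * real (Suc n)) (hermite_poly n)"
proof (rule poly_eqI)
  fix d
  show "coeff (pderiv (hermite_poly (Suc n))) d = coeff (smult (2 * real (Suc n)) (hermite_poly n)) d"
  proof (cases "\<exists>k. n = d + 2 * k")
    case True
    then obtain k where k: "n = d + 2 * k" by blast
    have "Suc n = Suc d + 2 * k" using k by simp
    then have upper: "coeff (hermite_poly (Suc n)) (Suc d) =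
        (-1) ^ k * fact (Suc n) * 2 ^ Suc d / (fact k * fact (Suc d))"
      using coeff_hermite_poly_add[of "Suc d" k] by simp
    have lower: "coeff (hermite_poly n) d = (-1) ^ k * fact n * 2 ^ d / (fact k * fact d)"
      unfolding k by (rule coeff_hermite_poly_add)
    show ?thesis
      unfolding coeff_pderiv coeff_smult upper lower
      by (simp add: divide_simps del: of_nat_Suc)
  next
    case False
    then show ?thesis
      by (simp add: coeff_pderiv coeff_hermite_poly_eq_0)
  qed
qed

lemma hermite_poly_Suc:
  "hermite_poly (Suc n) = [:0, 2:] * hermite_poly n - pderiv (hermite_poly n)"
proof (rule poly_eqI)
  fix d
  show "coeff (hermite_poly (Suc n)) d = coeff ([:0, 2:] * hermite_poly n - pderiv (hermite_poly n)) d"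
  proof (cases "\<exists>k. Suc n = d + 2 * k")
    case False
    have "n \<noteq> Suc d + 2 * k" for k
      using False[simplified, rule_format, of "Suc k"] by simp
    moreover have "n \<noteq> e + 2 * k" if "d = Suc e" for e k
      using False that by auto
    ultimately show ?thesis
      using False by (cases d) (simp_all add: coeff_pderiv coeff_hermite_poly_eq_0)
  next
    case True
    then obtain k where k: "Suc n = d + 2 * k" by blast
    \<comment> \<open>The two terms on the right contribute the shares \<open>d\<close> and \<open>2 k\<close> of the factor
        \<open>n + 1 = d + 2 k\<close> in \<open>(n + 1)!\<close>.\<close>
    have lhs: "coeff (hermite_poly (Suc n)) d = (-1) ^ k * fact (Suc n) * 2 ^ d / (fact k * fact d)"
      unfolding k by simp
    have der: "coeff (hermite_poly n) (Suc d) * real (Suc d) =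
        - (2 * real k) * ((-1) ^ k * fact n * 2 ^ d / (fact k * fact d))"
    proof (cases k)
      case 0
      then have "coeff (hermite_poly n) (Suc d) = 0"
        using k by (intro coeff_hermite_poly_eq_0) auto
      with 0 show ?thesis by simp
    next
      case (Suc l)
      then have n: "n = Suc d + 2 * l" using k by simp
      have eq: "coeff (hermite_poly n) (Suc d) = (-1) ^ l * fact n * 2 ^ Suc d / (fact l * fact (Suc d))"
        unfolding n by (rule coeff_hermite_poly_add)
      show ?thesis
        unfolding eq Suc by (simp add: divide_simps del: of_nat_Suc)
    qed
    have shift: "coeff ([:0, 2:] * hermite_poly n) d =
        real d * ((-1) ^ k * fact n * 2 ^ d / (fact k * fact d))"
    proof (cases d)
      case (Suc e)
      then have n: "n = e + 2 * k" using k by simp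
      have "coeff (hermite_poly n) e = (-1) ^ k * fact n * 2 ^ e / (fact k * fact e)"
        unfolding n by (rule coeff_hermite_poly_add)
      then show ?thesis using Suc by (simp add: divide_simps del: of_nat_Suc)
    qed simp
    have "real (Suc n) = real d + 2 * real k" using k by simp
    then show ?thesis
      unfolding lhs coeff_diff coeff_pderiv shift using der
      by (simp add: field_simps del: of_nat_Suc)
  qed
qed

lemma higher_pderiv_hermite_poly:
  assumes "k \<le> n"
  shows "(pderiv ^^ k) (hermite_poly n) = smult (2 ^ k * fact n / fact (n - k)) (hermite_poly (n - k))"
  using assms
proof (induction k)
  case (Suc k)
  then have "n - k = Suc (n - Suc k)" by simp
  with Suc show ?case
    by (simp add: pderiv_smult pderiv_hermite_poly_Suc mult_ac del: of_nat_Suc)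
qed simp

section \<open>The exponential generating function\<close>

definition hermite_egf :: "real \<Rightarrow> real fps" where
  "hermite_egf x = Abs_fps (\<lambda>n. poly (hermite_poly n) x / fact n)"

lemma hermite_egf_nth [simp]: "hermite_egf x $ n = poly (hermite_poly n) x / fact n"
  by (simp add: hermite_egf_def)

text \<open>
  The differential equation \<open>G' = 2 (x - t) G\<close> is the three-term recurrence
  \<open>H\<^bsub>n+1\<^esub> = 2 x H\<^sub>n - 2 n H\<^bsub>n-1\<^esub>\<close>, divided by \<open>n!\<close> and summed.
\<close>

lemma fps_deriv_hermite_egf:
  "fps_deriv (hermite_egf x) = fps_of_poly [:2 * x, -2:] * hermite_egf x"
proof (rule fps_ext)
  fix n
  have linear: "fps_of_poly [:2 * x, -2:] = fps_const (2 * x) - fps_const 2 * fps_X"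
    by (rule fps_ext) (auto simp: coeff_pCons split: nat.split)
  have "(fps_of_poly [:2 * x, -2:] * hermite_egf x) $ n =
      2 * x * hermite_egf x $ n - (if n = 0 then 0 else 2 * hermite_egf x $ (n - 1))"
    unfolding linear by (simp add: left_diff_distrib mult.assoc del: hermite_egf_nth)
  also have "\<dots> = fps_deriv (hermite_egf x) $ n"
  proof (cases n)
    case 0
    then show ?thesis by (simp add: hermite_poly_Suc[of 0] pderiv_1)
  next
    case (Suc k)
    have "poly (hermite_poly (Suc (Suc k))) x =
        2 * x * poly (hermite_poly (Suc k)) x - 2 * real (Suc k) * poly (hermite_poly k) x"
      by (simp add: hermite_poly_Suc[of "Suc k"] pderiv_hermite_poly_Suc del: of_nat_Suc)
    moreover have "poly (hermite_poly k) x / fact k =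
        real (Suc k) * poly (hermite_poly k) x / fact (Suc k)"
      by (simp del: of_nat_Suc)
    moreover have "fps_deriv (hermite_egf x) $ n = poly (hermite_poly (Suc (Suc k))) x / fact (Suc k)"
      by (simp add: Suc fact_Suc[of "Suc k"] del: of_nat_Suc fact_Suc)
    ultimately show ?thesis
      by (simp add: Suc diff_divide_distrib del: of_nat_Suc fact_Suc)
  qed
  finally show "fps_deriv (hermite_egf x) $ n = (fps_of_poly [:2 * x, -2:] * hermite_egf x) $ n" ..
qed

text \<open>
  A Rodrigues formula. In the induction step the product rule and the differential equation turn the
  factor \<open>H\<^sub>i(x - t)\<close> into \<open>2 (x - t) H\<^sub>i(x - t) - H\<^sub>i'(x - t)\<close>, the sign coming from the inner derivative, and
  this is \<open>H\<^bsub>i+1\<^esub>(x - t)\<close> by \<open>hermite_poly_Suc\<close>.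
\<close>

lemma higher_fps_deriv_hermite_egf:
  "(fps_deriv ^^ i) (hermite_egf x) = fps_of_poly (hermite_poly i \<circ>\<^sub>p [:x, -1:]) * hermite_egf x"
proof (induction i)
  case (Suc i)
  let ?p = "hermite_poly i \<circ>\<^sub>p [:x, -1:]"
  have "(fps_deriv ^^ Suc i) (hermite_egf x) =
      fps_of_poly (pderiv ?p + [:2 * x, -2:] * ?p) * hermite_egf x"
    by (simp only: funpow.simps o_apply Suc fps_deriv_mult fps_deriv_hermite_egf fps_of_poly_add
        fps_of_poly_mult fps_of_poly_pderiv algebra_simps)
  also have "pderiv ?p + [:2 * x, -2:] * ?p = hermite_poly (Suc i) \<circ>\<^sub>p [:x, -1:]"
  proof -
    have "[:0, 2:] \<circ>\<^sub>p [:x, -1:] = [:2 * x, -2:]"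
      by (simp add: pcompose_pCons)
    moreover have "pderiv ?p = - (pderiv (hermite_poly i) \<circ>\<^sub>p [:x, -1:])"
      by (simp add: pderiv_pcompose pderiv_pCons)
    ultimately show ?thesis
      by (simp only: hermite_poly_Suc pcompose_diff pcompose_mult)
  qed
  finally show ?case .
qed (simp add: pcompose_1)

lemma higher_fps_deriv_hermite_egf_nth:
  "(fps_deriv ^^ i) (hermite_egf x) $ n = poly (hermite_poly (n + i)) x / fact n"
  by (induction i arbitrary: n) (simp_all del: of_nat_Suc)

text \<open>
  The case \<open>\<gamma>\<^sub>n = n choose i\<close> of the eigenvalue problem, up to the factor \<open>i!\<close>: the Euler-type operator
  \<open>t^i\<close> times the \<open>i\<close>-th derivative scales \<open>t^n\<close> by the falling factorial \<open>n! / (n - i)!\<close>. The general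
  eigenvalue sequence is a combination of these.
\<close>

lemma hermite_egf_binomial_multiplier_nth:
  "(fps_X ^ i * fps_of_poly (hermite_poly i \<circ>\<^sub>p [:x, -1:]) * hermite_egf x) $ n =
     fact i * real (n choose i) * hermite_egf x $ n"
proof -
  have "(fps_X ^ i * fps_of_poly (hermite_poly i \<circ>\<^sub>p [:x, -1:]) * hermite_egf x) $ n =
      (fps_X ^ i * (fps_deriv ^^ i) (hermite_egf x)) $ n"
    by (simp add: higher_fps_deriv_hermite_egf mult.assoc)
  then show ?thesis
    by (simp add: fps_X_power_mult_nth higher_fps_deriv_hermite_egf_nth binomial_fact)
qed

section \<open>Binomial inversion\<close>

text \<open>
  At \<open>-1\<close> the reversed Jensen polynomials form the signed binomial transform of \<open>\<gamma>\<close>. On exponential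
  generating functions this is multiplication by \<open>exp (-t)\<close>, so multiplication by \<open>exp t\<close> undoes it.
\<close>

lemma binomial_inversion_rev_jensen:
  "(\<Sum>i\<le>n. real (n choose i) * poly (rev_jensen_poly \<gamma> i) (-1)) = \<gamma> n"
proof -
  define c where "c i = poly (rev_jensen_poly \<gamma> i) (-1)" for i
  let ?C = "Abs_fps (\<lambda>n. c n / fact n)" and ?G = "Abs_fps (\<lambda>n. \<gamma> n / fact n)"
  have "?C = ?G * fps_exp (-1)"
    by (rule fps_ext)
      (simp add: c_def rev_jensen_poly_def poly_sum poly_monom fps_mult_nth atLeast0AtMost
        sum_divide_distrib binomial_fact)
  then have "?C * fps_exp 1 = ?G"
    by (simp add: mult.assoc fps_exp_add_mult[symmetric])
  then have "fact n * (?C * fps_exp 1) $ n = \<gamma> n"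
    by simp
  then show ?thesis
    unfolding c_def[symmetric]
    by (simp add: fps_mult_nth atLeast0AtMost sum_distrib_left binomial_fact)
qed

section \<open>The symbol of the operator\<close>

text \<open>
  \<open>D^k\<close> sends \<open>H\<^sub>n / n!\<close> to \<open>2^k H\<^bsub>n-k\<^esub> / (n - k)!\<close>, so the value of the operator at \<open>H\<^sub>n / n!\<close> is a
  convolution, that is, a coefficient of a product of power series.
\<close>

lemma symbol_mult_hermite_egf_nth:
  assumes "diff_op Q (hermite_poly n) = smult g (hermite_poly n)"
  shows "(Abs_fps (\<lambda>m. 2 ^ m * poly (Q m) x) * hermite_egf x) $ n = g * hermite_egf x $ n"
proof -
  have "diff_op Q (hermite_poly n) = (\<Sum>k\<le>n. Q k * (pderiv ^^ k) (hermite_poly n))"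
    unfolding diff_op_eq_sum using degree_hermite_poly_le
    by (intro sum.mono_neutral_left) (auto simp: higher_pderiv_eq_0)
  then have "g * poly (hermite_poly n) x = 
      (\<Sum>k\<le>n. poly (Q k) x * (2 ^ k * fact n / fact (n - k) * poly (hermite_poly (n - k)) x))"
    using arg_cong[OF assms, of "\<lambda>p. poly p x"]
    by (simp add: poly_sum higher_pderiv_hermite_poly mult_ac)
  then have "g * poly (hermite_poly n) x / fact n = 
      (\<Sum>k\<le>n. 2 ^ k * poly (Q k) x * (poly (hermite_poly (n - k)) x / fact (n - k)))"
    by (simp add: sum_divide_distrib mult_ac)
  then show ?thesis
    by (simp add: fps_mult_nth atLeast0AtMost)
qed

text \<open>
  Dividing by a unit is causal: the quotient up to order \<open>m\<close> depends only on the product up to order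
  \<open>m\<close>. This allows the series for the symbol to be replaced by a finite sum.
\<close>

lemma fps_nth_eq_if_mult_nth_eq:
  fixes f g h :: "'a :: field fps"
  assumes "h $ 0 \<noteq> 0" and "\<And>n. n \<le> m \<Longrightarrow> (f * h) $ n = (g * h) $ n"
  shows "f $ m = g $ m"
proof -
  have "(f * h * inverse h) $ m = (g * h * inverse h) $ m"
    unfolding fps_mult_nth[of "_ * h"] using assms(2) by (intro sum.cong) auto
  then show ?thesis
    using assms(1) by (simp add: mult.assoc inverse_mult_eq_1')
qed

lemma symbol_nth:
  assumes "\<And>n. diff_op Q (hermite_poly n) = smult (\<gamma> n) (hermite_poly n)"
  shows "2 ^ m * poly (Q m) x = (\<Sum>i\<le>m. poly (rev_jensen_poly \<gamma> i) (-1) / fact i *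
           coeff (hermite_poly i \<circ>\<^sub>p [:x, -1:]) (m - i))"
proof -
  define c where "c i = poly (rev_jensen_poly \<gamma> i) (-1)" for i
  define F where "F i = fps_X ^ i * fps_of_poly (hermite_poly i \<circ>\<^sub>p [:x, -1:])" for i
  \<comment> \<open>The expected symbol, truncated: summands with \<open>i > m\<close> only affect powers of \<open>t\<close> above \<open>t^m\<close>.\<close>
  define R where "R = (\<Sum>i\<le>m. fps_const (c i / fact i) * F i)"
  have "Abs_fps (\<lambda>m. 2 ^ m * poly (Q m) x) $ m = R $ m"
  proof (rule fps_nth_eq_if_mult_nth_eq[of "hermite_egf x"])
    fix n assume n: "n \<le> m"
    have "(R * hermite_egf x) $ n = (\<Sum>i\<le>m. c i / fact i * (F i * hermite_egf x) $ n)"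
      by (simp add: R_def sum_distrib_right fps_sum_nth mult.assoc)
    also have "\<dots> = (\<Sum>i\<le>m. real (n choose i) * c i) * hermite_egf x $ n"
      unfolding F_def hermite_egf_binomial_multiplier_nth
      by (simp add: sum_distrib_left mult_ac del: hermite_egf_nth)
    also have "(\<Sum>i\<le>m. real (n choose i) * c i) = (\<Sum>i\<le>n. real (n choose i) * c i)"
      using n by (intro sum.mono_neutral_right) auto
    also have "\<dots> = \<gamma> n"
      unfolding c_def by (rule binomial_inversion_rev_jensen)
    finally show "(Abs_fps (\<lambda>m. 2 ^ m * poly (Q m) x) * hermite_egf x) $ n = (R * hermite_egf x) $ n"
      using symbol_mult_hermite_egf_nth[OF assms] by simp
  qed simp
  then show ?thesis
    by (simp add: R_def F_def c_def fps_sum_nth fps_X_power_mult_nth)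
qed

section \<open>Extracting coefficients\<close>

lemma pcompose_power:
  fixes p q :: "'a :: comm_semiring_1 poly"
  shows "(p ^ n) \<circ>\<^sub>p q = (p \<circ>\<^sub>p q) ^ n"
  by (induction n) (simp_all add: pcompose_mult pcompose_1)

text \<open>
  The index set \<open>2 * j + a \<le> i\<close> keeps exactly those monomials of \<open>H\<^sub>i\<close> whose degree \<open>i - 2 * j\<close> is large
  enough for \<open>(x - t)^(i - 2 * j)\<close> to contain \<open>t^a\<close>, so all subtractions in the summand are proper.
\<close>

lemma coeff_hermite_poly_pcompose_linear:
  "coeff (hermite_poly i \<circ>\<^sub>p [:x, -1:]) a =
     (\<Sum>j | 2 * j + a \<le> i. (-1) ^ (a + j) * fact i * 2 ^ (i - 2 * j) * x ^ (i - 2 * j - a) /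
        (fact j * fact a * fact (i - 2 * j - a)))"
proof -
  let ?f = "\<lambda>j. (-1) ^ j * fact i * 2 ^ (i - 2 * j) / (fact j * fact (i - 2 * j)) *
      coeff ([:x, -1:] ^ (i - 2 * j)) a :: real"
  have "coeff (hermite_poly i \<circ>\<^sub>p [:x, -1:]) a = (\<Sum>j\<le>i div 2. ?f j)"
    by (simp add: hermite_poly_def pcompose_sum coeff_sum monom_altdef pcompose_smult
        pcompose_power pcompose_pCons)
  also have "\<dots> = (\<Sum>j | 2 * j + a \<le> i. ?f j)"
  proof (rule sum.mono_neutral_right)
    show "\<forall>j \<in> {..i div 2} - {j. 2 * j + a \<le> i}. ?f j = 0"
    proof
      fix j assume "j \<in> {..i div 2} - {j. 2 * j + a \<le> i}"
      then have "i - 2 * j < a" by auto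
      then have "degree ([:x, -1:] ^ (i - 2 * j)) < a"
        by (simp add: degree_power_eq)
      then show "?f j = 0" by (simp add: coeff_eq_0)
    qed
  qed auto
  also have "\<dots> = (\<Sum>j | 2 * j + a \<le> i. (-1) ^ (a + j) * fact i * 2 ^ (i - 2 * j) *
      x ^ (i - 2 * j - a) / (fact j * fact a * fact (i - 2 * j - a)))"
  proof (rule sum.cong)
    fix j assume "j \<in> {j. 2 * j + a \<le> i}"
    then have "a \<le> i - 2 * j" by simp
    then show "?f j = (-1) ^ (a + j) * fact i * 2 ^ (i - 2 * j) *
      x ^ (i - 2 * j - a) / (fact j * fact a * fact (i - 2 * j - a))"
      by (simp add: coeff_linear_poly_power binomial_fact power_add mult_ac)
  qed simp
  finally show ?thesis .
qed

theorem theorem36: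
  fixes \<gamma> :: "nat \<Rightarrow> real" and Q :: "nat \<Rightarrow> real poly"
  assumes "\<forall>n. diff_op Q (hermite_poly n) = smult (\<gamma> n) (hermite_poly n)"
  shows "\<forall>m. Q m = (\<Sum>k\<le>m div 2.
           smult ((-1) ^ k / (fact k * 2 ^ k) *
                  (\<Sum>j\<le>k. of_nat (k choose j) * (poly (rev_jensen_poly \<gamma> (m - k + j)) (-1) / 2 ^ j)))
                 (monom (1 / fact (m - 2 * k)) (m - 2 * k)))"
proof
  fix m
  define c where "c i = poly (rev_jensen_poly \<gamma> i) (-1)" for i
  let ?rhs = "\<Sum>k\<le>m div 2. smult ((-1) ^ k / (fact k * 2 ^ k) *
      (\<Sum>j\<le>k. of_nat (k choose j) * (c (m - k + j) / 2 ^ j)))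
      (monom (1 / fact (m - 2 * k)) (m - 2 * k))"
  have "poly (Q m) x = poly ?rhs x" for x
  proof -
    \<comment> \<open>\<open>s i j\<close> is the contribution to the coefficient of \<open>t^m\<close> in the symbol from the \<open>j\<close>-th monomial
        of \<open>H\<^sub>i\<close>; \<open>t k j\<close> is the \<open>j\<close>-th summand of the \<open>k\<close>-th term of the claimed formula.\<close>
    define s where "s i j = c i * (-1) ^ (m - i + j) * 2 ^ (i - 2 * j) * x ^ (i - 2 * j - (m - i)) /
        (fact j * fact (m - i) * fact (i - 2 * j - (m - i)))" for i j
    define t where "t k j = (-1) ^ k / (fact k * 2 ^ k) * (real (k choose j) * (c (m - k + j) / 2 ^ j)) *
        (x ^ (m - 2 * k) / fact (m - 2 * k))" for k j
    have "2 ^ m * poly (Q m) x = (\<Sum>i\<le>m. \<Sum>j | 2 * j + (m - i) \<le> i. s i j)"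
      unfolding symbol_nth[of Q \<gamma>, OF assms[rule_format]] coeff_hermite_poly_pcompose_linear
        c_def[symmetric] sum_distrib_left s_def
      by (simp add: mult_ac)
    also have "\<dots> = (\<Sum>(i, j) \<in> Sigma {..m} (\<lambda>i. {j. 2 * j + (m - i) \<le> i}). s i j)"
      by (rule sum.Sigma) (auto intro: finite_subset[of _ "{..m}"])
    \<comment> \<open>The power of \<open>x\<close> in \<open>s i j\<close> is \<open>(i - 2 j) - (m - i) = m - 2 (m - i + j)\<close>, so collecting equal
        powers of \<open>x\<close> means taking \<open>k = m - i + j\<close> as the outer index.\<close>
    also have "\<dots> = (\<Sum>(k, j) \<in> Sigma {..m div 2} (\<lambda>k. {..k}). 2 ^ m * t k j)"
    proof (rule sum.reindex_bij_witness[where j = "\<lambda>(i, j). (m - i + j, j)"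
          and i = "\<lambda>(k, j). (m - k + j, j)"])
      fix p assume p: "p \<in> Sigma {..m} (\<lambda>i. {j. 2 * j + (m - i) \<le> i})"
      obtain i j where ij: "p = (i, j)" by force
      \<comment> \<open>In terms of \<open>a\<close>, \<open>j\<close> and \<open>l\<close>, the exponents of \<open>t\<close> (from the binomial expansion) and of \<open>x\<close>
          being \<open>a\<close> and \<open>l\<close>, every index is a sum and no truncated subtraction is left.\<close>
      define a where "a = m - i"
      define l where "l = i - 2 * j - a"
      have i: "i = 2 * j + a + l" and m: "m = 2 * (a + j) + l"
        using p unfolding ij a_def l_def by auto
      \<comment> \<open>The powers of 2 split into those from \<open>k\<close>, from \<open>j\<close>, and from the monomial of \<open>H\<^sub>i\<close>.\<close>
      have "(2::real) ^ m = 2 ^ (a + j) * 2 ^ j * 2 ^ (a + l)"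
        unfolding m by (simp add: power_add mult_2 mult_2_right mult_ac)
      moreover have "m - (a + j) + j = i" "m - 2 * (a + j) = l" "i - 2 * j = a + l"
        unfolding i m by auto
      ultimately have "2 ^ m * t (a + j) j = s i j"
        unfolding t_def s_def a_def[symmetric]
        by (simp add: binomial_fact divide_simps)
      then show "(case case p of (i, j) \<Rightarrow> (m - i + j, j) of (k, j) \<Rightarrow> 2 ^ m * t k j) =
          (case p of (i, j) \<Rightarrow> s i j)"
        by (simp add: ij a_def)
    qed auto
    also have "\<dots> = 2 ^ m * (\<Sum>k\<le>m div 2. \<Sum>j\<le>k. t k j)"
      by (simp add: sum.Sigma[symmetric] sum_distrib_left)
    finally have "poly (Q m) x = (\<Sum>k\<le>m div 2. \<Sum>j\<le>k. t k j)"
      by simp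
    also have "\<dots> = poly ?rhs x"
      by (simp add: t_def poly_sum poly_monom sum_distrib_left sum_distrib_right sum_divide_distrib)
    finally show ?thesis .
  qed
  then have "Q m = ?rhs"
    by (simp only: poly_eq_poly_eq_iff[symmetric] fun_eq_iff) simp
  then show "Q m = (\<Sum>k\<le>m div 2.
           smult ((-1) ^ k / (fact k * 2 ^ k) *
                  (\<Sum>j\<le>k. of_nat (k choose j) * (poly (rev_jensen_poly \<gamma> (m - k + j)) (-1) / 2 ^ j)))
                 (monom (1 / fact (m - 2 * k)) (m - 2 * k)))"
    by (simp only: c_def)
qed

end
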